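(* Let $f:\mathbb E\to\mathbb R\cup\{+\infty\}$ be a proper extended real function, $\bar x\in\mathrm{dom}\,f$, and let $n$ be a positive integer. Then the following claims are equivalent: (a) $\bar x$ is an isolated local minimizer of order $n$ of $f$, and for every positive integer $k<n$ the point $\bar x$ is not an isolated local minimizer of order $k$; (b) $0\in\partial^{(1)}_-f(\bar x)$, $0\in\partial^{(i)}_-f(\bar x;\underbrace{0,\dots,0}_{(i-1)\text{ times}})$ for all $i=1,2,\dots,n-1$, \[ f^{(n)}_-(\bar x;\underbrace{0,0,\dots,0}_{(n-1)\text{ times}};u)>0\quad\text{for all } u\in\mathbb E\setminus\{0\}, \] and for every positive integer $k<n$ there exists a direction $d_k\neq0$ such that $f^{(k)}_-(\bar x;\underbrace{0,0,\dots,0}_{(k-1)\text{ times}};d_k)=0$; (c) $f^{\downarrow}_k(\bar x)=0$ for every positive integer $k<n$, and $f^{\downarrow}_n(\bar x)>0$.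
   Context: $\mathbb E$ is a real finite-dimensional Euclidean space. $L^1(\mathbb E)=L(\mathbb E,\mathbb R)$ is the space of continuous linear functionals on $\mathbb E$ and, for $n>1$, $L^n(\mathbb E)=L(\mathbb E,L^{n-1}(\mathbb E))$. A proper extended real function is $f:\mathbb E\to\mathbb R\cup\{+\infty\}$ having at least one finite value; $\mathrm{dom}\,f=\{x\mid f(x)<+\infty\}$. For $x\in\mathrm{dom}\,f$ and $u\in\mathbb E$, \[ f^{(1)}_-(x;u)=\liminf_{t\downarrow 0,\,u'\to u}t^{-1}[f(x+tu')-f(x)],\qquad \partial^{(1)}_-f(x)=\{x^*\in L^1(\mathbb E)\mid x^*(u)\le f^{(1)}_-(x;u)\ \forall u\in\mathbb E\}. \] Recursively, for $n>1$: given $x^*_i\in\partial^{(i)}_-f(x;x_1^*,\dots,x_{i-1}^* )$ for $i=1,\dots,n-1$ (for $i=1$ this means $x_1^*\in\partial^{(1)}_-f(x)$), the lower Hadamard derivative of order $n$ is \[ f^{(n)}_-(x;x_1^*,\dots,x_{n-1}^*;u)=\liminf_{t\downarrow0,\,u'\to u} n!\,t^{-n}\Big[f(x+tu')-f(x)-\sum_{i=1}^{n-1}\frac{t^i}{i!}\,x_i^*\underbrace{(u')\cdots(u')}_{i\text{ times}}\Big]\in[-\infty,+\infty], \] and it is defined only for such $x_i^*$. The lower Hadamard subdifferential of order $n$ is \[ \partial^{(n)}_-f(x;x_1^*,\dots,x_{n-1}^* )=\{x^*\in L^n(\mathbb E)\mid x^*\underbrace{(u)\cdots(u)}_{n\text{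 times}}\le f^{(n)}_-(x;x_1^*,\dots,x_{n-1}^*;u)\ \forall u\in\mathbb E\}. \] For order $1$ with no zeros, $f^{(1)}_-(\bar x;0,\dots,0;u)$ means $f^{(1)}_-(\bar x;u)$. Isolated local minimizer of order $n$: a point $\bar x\in\mathrm{dom}\,f$ for which there exist a neighborhood $N$ of $\bar x$ and a constant $C>0$ with $f(x)\ge f(\bar x)+C\|x-\bar x\|^n$ for all $x\in N$. Demyanov's derivative of order $k$ ($k$ a positive integer) at $x\in\mathrm{dom}\,f$: \[ f^{\downarrow}_k(x)=\liminf_{y\to x,\,y\ne x}\frac{f(y)-f(x)}{\|y-x\|^k}\in[-\infty,+\infty]. \] *)

theory Defs
  imports "HOL-Analysis.Analysis"
begin

definition proper_fun :: "('a \<Rightarrow> ereal) \<Rightarrow> bool" where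
  "proper_fun f \<longleftrightarrow> (\<forall>x. f x \<noteq> -\<infinity>) \<and> (\<exists>x. f x \<noteq> \<infinity>)"

definition edom :: "('a \<Rightarrow> ereal) \<Rightarrow> 'a set" where
  "edom f = {x. f x < \<infinity>}"

text \<open>
  Since \<open>n\<close> varies, the iterated spaces \<open>L\<^sup>n(E) = L(E, L\<^sup>n\<^sup>-\<^sup>1(E))\<close> cannot be iterated function types.
  The functional \<open>\<phi>\<close> in \<open>L\<^sup>n(E)\<close> is encoded as the function that maps the argument list
  \<open>[u\<^sub>1, \<dots>, u\<^sub>n]\<close> to the real number \<open>\<phi>(u\<^sub>1)\<cdots>(u\<^sub>n)\<close> and every list of another length to 0
  (so that the encoding is unique). The recursion starts at \<open>L\<^sup>0(E)\<close>, the real numbers.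
  As \<open>E\<close> is finite-dimensional, a map into \<open>L\<^sup>n\<^sup>-\<^sup>1(E)\<close> is continuous and linear iff it is so
  after evaluation at all arguments.
\<close>

fun Lspace :: "nat \<Rightarrow> ('a::euclidean_space list \<Rightarrow> real) set" where
  "Lspace 0 = {\<phi>. \<forall>us. us \<noteq> [] \<longrightarrow> \<phi> us = 0}"
| "Lspace (Suc n) = {\<phi>. \<phi> [] = 0 \<and>
      (\<forall>u. (\<lambda>us. \<phi> (u # us)) \<in> Lspace n) \<and>
      (\<forall>us. bounded_linear (\<lambda>u. \<phi> (u # us)))}"

definition zero_form :: "'a list \<Rightarrow> real" where
  "zero_form = (\<lambda>us. 0)"

lemma zero_form_in_Lspace: "zero_form \<in> Lspace n"
  unfolding zero_form_def by (induction n) auto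

text \<open>
  \<open>hadamard_deriv f x [x\<^sub>1, \<dots>, x\<^sub>n\<^sub>-\<^sub>1] u\<close> is the lower Hadamard derivative of order \<open>n\<close>, i.e. the
  order is one more than the length of the list, and \<open>x\<^sub>i\<close> is the list element with index \<open>i - 1\<close>.
  The derivative and the subdifferential are meaningful only if each \<open>x\<^sub>i\<close> lies in
  \<open>hadamard_subdiff f x [x\<^sub>1, \<dots>, x\<^sub>i\<^sub>-\<^sub>1]\<close>; the definitions are totalised by the same formulas.
  The variable \<open>v\<close> tending to \<open>u\<close> may take the value \<open>u\<close>.
\<close>

definition hadamard_deriv ::
  "('a::euclidean_space \<Rightarrow> ereal) \<Rightarrow> 'a \<Rightarrow> ('a list \<Rightarrow> real) list \<Rightarrow> 'a \<Rightarrow> ereal" where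
  "hadamard_deriv f x xs u =
     (let n = Suc (length xs) in
      Liminf (at_right 0 \<times>\<^sub>F nhds u)
        (\<lambda>(t::real, v). ereal (fact n / t ^ n) *
           (f (x + t *\<^sub>R v) - f x
              - ereal (\<Sum>i=1..<n. t ^ i / fact i * (xs ! (i - 1)) (replicate i v)))))"

definition hadamard_subdiff ::
  "('a::euclidean_space \<Rightarrow> ereal) \<Rightarrow> 'a \<Rightarrow> ('a list \<Rightarrow> real) list \<Rightarrow> ('a list \<Rightarrow> real) set" where
  "hadamard_subdiff f x xs =
     (let n = Suc (length xs) in
      {\<phi> \<in> Lspace n. \<forall>u. ereal (\<phi> (replicate n u)) \<le> hadamard_deriv f x xs u})"

definition isolated_local_minimizer ::
  "('a::euclidean_space \<Rightarrow> ereal) \<Rightarrow> nat \<Rightarrow> 'a \<Rightarrow> bool" where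
  "isolated_local_minimizer f n x \<longleftrightarrow>
     x \<in> edom f \<and>
     (\<exists>N C. x \<in> interior N \<and> C > 0 \<and> (\<forall>y\<in>N. f y \<ge> f x + ereal (C * norm (y - x) ^ n)))"

definition demyanov_deriv ::
  "('a::euclidean_space \<Rightarrow> ereal) \<Rightarrow> nat \<Rightarrow> 'a \<Rightarrow> ereal" where
  "demyanov_deriv f k x = Liminf (at x) (\<lambda>y. (f y - f x) / ereal (norm (y - x) ^ k))"

end

theory Submission
  imports Defs
begin

text \<open>
  With zero forms in the preceding orders, the lower Hadamard derivative of order \<open>k\<close> is the lower
  limit of \<open>k! / t\<^sup>k * (f (x + t v) - f x)\<close>. Both it and Demyanov's derivative therefore measure the
  growth of \<open>f - f x\<close> against the \<open>k\<close>-th power of the distance to \<open>x\<close>, the first one direction by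
  direction and the second one in all directions at once.

  For each single order \<open>k > 0\<close>, the following are equivalent: \<open>x\<close> is an isolated local minimizer of
  order \<open>k\<close>; Demyanov's derivative of order \<open>k\<close> is positive; the Hadamard derivative of order \<open>k\<close> is
  positive in every direction \<open>u \<noteq> 0\<close>
  (\<open>isolated_local_minimizer_iff_demyanov\<close>, \<open>isolated_local_minimizer_iff_hadamard\<close>). That positivity
  in each direction suffices is due to the compactness of the unit sphere: positivity at \<open>u\<close> gives an
  estimate that is uniform near \<open>u\<close>, and finitely many such neighbourhoods cover the sphere.

  An isolated local minimizer of some order is a local minimizer, so at such a point none of the
  derivatives of any order is negative. Consequently, failing to be an isolated local minimizer of
  order \<open>k < n\<close> means precisely that Demyanov's derivative of order \<open>k\<close> vanishes, and that the
  Hadamard derivative of order \<open>k\<close> vanishes in some direction. The three claims are these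
  equivalences for the orders up to \<open>n\<close>.
\<close>

section \<open>Growth of a function near a point\<close>

definition grows_near :: "('a::euclidean_space \<Rightarrow> ereal) \<Rightarrow> 'a \<Rightarrow> real \<Rightarrow> nat \<Rightarrow> bool" where
  "grows_near f x C k \<longleftrightarrow> (\<forall>\<^sub>F y in nhds x. f x + ereal (C * norm (y - x) ^ k) \<le> f y)"

lemma isolated_local_minimizer_iff_grows_near:
  "isolated_local_minimizer f k x \<longleftrightarrow> x \<in> edom f \<and> (\<exists>C>0. grows_near f x C k)"
proof -
  have "(\<exists>N. x \<in> interior N \<and> (\<forall>y\<in>N. P y)) \<longleftrightarrow> (\<forall>\<^sub>F y in nhds x. P y)" for P
  proof
    assume "\<exists>N. x \<in> interior N \<and> (\<forall>y\<in>N. P y)"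
    then show "\<forall>\<^sub>F y in nhds x. P y"
      unfolding eventually_nhds interior_def by blast
  next
    assume "\<forall>\<^sub>F y in nhds x. P y"
    then obtain S where "open S" "x \<in> S" "\<forall>y\<in>S. P y"
      unfolding eventually_nhds by blast
    then show "\<exists>N. x \<in> interior N \<and> (\<forall>y\<in>N. P y)"
      by (metis interior_open)
  qed
  from this[of "\<lambda>y. f x + ereal (_ * norm (y - x) ^ k) \<le> f y"] show ?thesis
    unfolding isolated_local_minimizer_def grows_near_def by blast
qed

text \<open>Growth at rate \<open>C = 0\<close> is plain local minimality, whatever the exponent.\<close>

lemma grows_near_weaken:
  assumes "grows_near f x C n" "C \<ge> 0"
  shows "grows_near f x 0 k"
  using assms(1) unfolding grows_near_def
proof eventually_elim
  case (elim y)
  have "f x + 0 \<le> f x + ereal (C * norm (y - x) ^ n)"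
    using assms(2) by (intro add_left_mono) simp
  with elim show ?case
    by (simp add: zero_ereal_def[symmetric])
qed

lemma ereal_le_scaled_diff_iff:
  fixes b :: ereal
  assumes "r > 0"
  shows "ereal c \<le> ereal r * (b - ereal a) \<longleftrightarrow> ereal a + ereal (c / r) \<le> b"
  using assms by (cases b) (auto simp: field_simps)

lemma finite_at_edom:
  assumes "proper_fun f" "x \<in> edom f"
  obtains a where "f x = ereal a"
  using assms unfolding proper_fun_def edom_def by (cases "f x") auto

section \<open>Demyanov's derivative\<close>

lemma demyanov_deriv_ge:
  assumes "f x = ereal a" "grows_near f x C k"
  shows "ereal C \<le> demyanov_deriv f k x"
  unfolding demyanov_deriv_def
proof (rule Liminf_bounded)
  have "\<forall>\<^sub>F y in at x. f x + ereal (C * norm (y - x) ^ k) \<le> f y"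
    using assms(2) unfolding grows_near_def eventually_at_filter
    by (rule eventually_mono) simp
  moreover have "\<forall>\<^sub>F y in at x. y \<noteq> x"
    by (simp add: eventually_at_filter)
  ultimately show "\<forall>\<^sub>F y in at x. ereal C \<le> (f y - f x) / ereal (norm (y - x) ^ k)"
  proof eventually_elim
    case (elim y)
    have "norm (y - x) ^ k > 0"
      using elim by simp
    then show ?case
      using elim assms(1) ereal_le_scaled_diff_iff[of "inverse (norm (y - x) ^ k)" C "f y" a]
      by (simp add: divide_ereal_def field_simps)
  qed
qed

lemma isolated_local_minimizer_iff_demyanov:
  assumes "f x = ereal a" "k > 0"
  shows "isolated_local_minimizer f k x \<longleftrightarrow> demyanov_deriv f k x > 0"
proof
  assume "isolated_local_minimizer f k x"
  then obtain C where "C > 0" "grows_near f x C k"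
    unfolding isolated_local_minimizer_iff_grows_near by blast
  then have "ereal C \<le> demyanov_deriv f k x"
    using demyanov_deriv_ge assms(1) by blast
  with \<open>C > 0\<close> show "demyanov_deriv f k x > 0"
    by (metis ereal_less(2) less_le_trans)
next
  assume "demyanov_deriv f k x > 0"
  then obtain C where C: "0 < ereal C" "ereal C < demyanov_deriv f k x"
    using ereal_dense2 by blast
  have "\<forall>\<^sub>F y in at x. ereal C < (f y - f x) / ereal (norm (y - x) ^ k)"
    using C(2) unfolding demyanov_deriv_def by (rule less_LiminfD)
  then have "grows_near f x C k"
    unfolding grows_near_def eventually_at_filter
  proof eventually_elim
    case (elim y)
    show ?case
    proof (cases "y = x")
      case True
      \<comment> \<open>The punctured lower limit ignores \<open>y = x\<close>; there the estimate holds because \<open>k > 0\<close>.\<close>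
      then show ?thesis using assms by (simp add: zero_power)
    next
      case False
      then have "norm (y - x) ^ k > 0" by simp
      then show ?thesis
        using less_imp_le[OF elim[rule_format, OF False]] False assms(1)
          ereal_le_scaled_diff_iff[of "inverse (norm (y - x) ^ k)" C "f y" a]
        by (simp add: divide_ereal_def field_simps)
    qed
  qed
  then show "isolated_local_minimizer f k x"
    unfolding isolated_local_minimizer_iff_grows_near using C(1) assms(1)
    by (auto simp: edom_def)
qed

section \<open>Hadamard derivatives with zero forms\<close>

lemma hadamard_deriv_zero_forms:
  assumes "k > 0"
  shows "hadamard_deriv f x (replicate (k - 1) zero_form) u =
    Liminf (at_right 0 \<times>\<^sub>F nhds u)
      (\<lambda>p. ereal (fact k / fst p ^ k) * (f (x + fst p *\<^sub>R snd p) - f x))"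
proof -
  have "(\<Sum>i=1..<k. t ^ i / fact i * (replicate (k - 1) zero_form ! (i - 1)) (replicate i v)) = 0"
    for t :: real and v :: 'a
    by (rule sum.neutral) (auto simp: zero_form_def)
  then show ?thesis
    using assms unfolding hadamard_deriv_def Let_def
    by (simp add: case_prod_unfold zero_ereal_def[symmetric])
qed

lemma zero_form_in_hadamard_subdiff_iff:
  "zero_form \<in> hadamard_subdiff f x xs \<longleftrightarrow> (\<forall>u. 0 \<le> hadamard_deriv f x xs u)"
  unfolding hadamard_subdiff_def Let_def
  by (simp add: zero_form_in_Lspace del: Lspace.simps) (simp add: zero_form_def zero_ereal_def)

text \<open>
  Directions \<open>v\<close> close to \<open>u\<close> have norm at least \<open>norm u / 2\<close>, so growth of \<open>f\<close> around \<open>x\<close> bounds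
  the difference quotient along \<open>v\<close>. The factor 2 is harmless: only the sign of the bound matters.
\<close>

lemma hadamard_deriv_ge:
  assumes fx: "f x = ereal a" and "k > 0" "C \<ge> 0" and grow: "grows_near f x C k"
  shows "ereal (fact k * (C * (norm u / 2) ^ k)) \<le>
    hadamard_deriv f x (replicate (k - 1) zero_form) u"
  unfolding hadamard_deriv_zero_forms[OF \<open>k > 0\<close>]
proof (rule Liminf_bounded)
  let ?F = "at_right (0::real) \<times>\<^sub>F nhds u"
  have t_lim: "((\<lambda>p. fst p) \<longlongrightarrow> 0) ?F"
    using filterlim_fst[of "at_right (0::real)" "nhds u"]
    by (rule filterlim_mono) (auto simp: at_within_def)
  have v_lim: "((\<lambda>p. snd p) \<longlongrightarrow> u) ?F"
    by (rule filterlim_snd)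
  have "((\<lambda>p. x + fst p *\<^sub>R snd p) \<longlongrightarrow> x + 0 *\<^sub>R u) ?F"
    by (intro tendsto_intros t_lim v_lim)
  then have "filterlim (\<lambda>p. x + fst p *\<^sub>R snd p) (nhds x) ?F"
    by simp
  with grow have "\<forall>\<^sub>F p in ?F.
      f x + ereal (C * norm (x + fst p *\<^sub>R snd p - x) ^ k) \<le> f (x + fst p *\<^sub>R snd p)"
    unfolding grows_near_def by (rule eventually_compose_filterlim)
  moreover have "\<forall>\<^sub>F p in ?F. fst p > 0"
    by (rule eventually_compose_filterlim[OF eventually_at_right_less filterlim_fst])
  moreover have "\<forall>\<^sub>F p in ?F. norm u / 2 \<le> norm (snd p)"
  proof (cases "u = 0")
    case False
    then have "\<forall>\<^sub>F p in ?F. norm u / 2 < norm (snd p)"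
      by (intro order_tendstoD(1)[OF tendsto_norm[OF v_lim]]) simp
    then show ?thesis by (rule eventually_mono) simp
  qed simp
  ultimately show "\<forall>\<^sub>F p in ?F. ereal (fact k * (C * (norm u / 2) ^ k))
      \<le> ereal (fact k / fst p ^ k) * (f (x + fst p *\<^sub>R snd p) - f x)"
  proof eventually_elim
    case (elim p)
    have "(norm u / 2) ^ k \<le> norm (snd p) ^ k"
      using elim(3) by (intro power_mono) auto
    then have "C * (norm u / 2) ^ k * fst p ^ k \<le> C * norm (snd p) ^ k * fst p ^ k"
      using elim(2) \<open>C \<ge> 0\<close> by (intro mult_right_mono mult_left_mono) auto
    also have "\<dots> = C * norm (x + fst p *\<^sub>R snd p - x) ^ k"
      using elim(2) by (simp add: power_mult_distrib)
    finally have "f x + ereal (C * (norm u / 2) ^ k * fst p ^ k)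
        \<le> f x + ereal (C * norm (x + fst p *\<^sub>R snd p - x) ^ k)"
      by (intro add_left_mono) simp
    also note elim(1)
    finally show ?case
      unfolding fx using elim(2) by (subst ereal_le_scaled_diff_iff) (auto simp: field_simps)
  qed
qed

text \<open>
  A single \<open>e\<close> serves as radius of the neighbourhood of \<open>u\<close>, as bound on the step length and as
  growth rate: the estimate is preserved when \<open>e\<close> shrinks, so finitely many of them can be replaced
  by their minimum.
\<close>

lemma hadamard_deriv_pos_imp_local_growth:
  assumes fx: "f x = ereal a" and "k > 0"
    and pos: "hadamard_deriv f x (replicate (k - 1) zero_form) u > 0"
  obtains e where "e > 0"
    "\<And>t v. 0 < t \<Longrightarrow> t < e \<Longrightarrow> dist v u < e \<Longrightarrow> f x + ereal (e * t ^ k) \<le> f (x + t *\<^sub>R v)"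
proof -
  obtain c where c: "0 < ereal c" "ereal c < hadamard_deriv f x (replicate (k - 1) zero_form) u"
    using pos ereal_dense2 by blast
  have "\<forall>\<^sub>F p in at_right 0 \<times>\<^sub>F nhds u.
      ereal c < ereal (fact k / fst p ^ k) * (f (x + fst p *\<^sub>R snd p) - f x)"
    using c(2) unfolding hadamard_deriv_zero_forms[OF \<open>k > 0\<close>] by (rule less_LiminfD)
  then obtain P Q where P: "eventually P (at_right 0)" and Q: "eventually Q (nhds u)"
    and PQ: "\<And>t v. P t \<Longrightarrow> Q v \<Longrightarrow>
      ereal c < ereal (fact k / t ^ k) * (f (x + t *\<^sub>R v) - f x)"
    unfolding eventually_prod_filter by auto
  obtain b where b: "b > 0" "\<And>t. 0 < t \<Longrightarrow> t < b \<Longrightarrow> P t"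
    using P unfolding eventually_at_right_field by auto
  obtain d where d: "d > 0" "\<And>v. dist v u < d \<Longrightarrow> Q v"
    using Q unfolding eventually_nhds_metric by auto
  define e where "e = min (c / fact k) (min b d)"
  show thesis
  proof
    show "e > 0" using b(1) d(1) c(1) by (simp add: e_def)
    fix t v assume t: "0 < t" "t < e" and v: "dist v u < e"
    have "ereal c \<le> ereal (fact k / t ^ k) * (f (x + t *\<^sub>R v) - f x)"
      using t v by (intro less_imp_le PQ b d) (auto simp: e_def)
    then have "ereal a + ereal (c / (fact k / t ^ k)) \<le> f (x + t *\<^sub>R v)"
      unfolding fx using t(1) by (subst (asm) ereal_le_scaled_diff_iff) auto
    moreover have "e * t ^ k \<le> c / fact k * t ^ k"
      using t(1) by (intro mult_right_mono) (auto simp: e_def)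
    then have "ereal a + ereal (e * t ^ k) \<le> ereal a + ereal (c / (fact k / t ^ k))"
      by simp
    ultimately show "f x + ereal (e * t ^ k) \<le> f (x + t *\<^sub>R v)"
      unfolding fx by (rule order_trans[rotated])
  qed
qed

lemma hadamard_deriv_pos_imp_grows_near:
  assumes fx: "f x = ereal a" and "k > 0"
    and pos: "\<And>u. u \<noteq> 0 \<Longrightarrow> hadamard_deriv f x (replicate (k - 1) zero_form) u > 0"
  shows "\<exists>C>0. grows_near f x C k"
proof -
  have "\<exists>e>0. \<forall>t v. 0 < t \<longrightarrow> t < e \<longrightarrow> dist v u < e \<longrightarrow>
      f x + ereal (e * t ^ k) \<le> f (x + t *\<^sub>R v)" if "u \<in> sphere 0 1" for u
  proof -
    have "u \<noteq> 0" using that by auto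
    from hadamard_deriv_pos_imp_local_growth[OF fx \<open>k > 0\<close> pos[OF this]]
    show ?thesis by metis
  qed
  then obtain e where e: "\<And>u. u \<in> sphere 0 1 \<Longrightarrow> e u > 0"
      "\<And>u t v. u \<in> sphere 0 1 \<Longrightarrow> 0 < t \<Longrightarrow> t < e u \<Longrightarrow> dist v u < e u \<Longrightarrow>
        f x + ereal (e u * t ^ k) \<le> f (x + t *\<^sub>R v)"
    by metis
  have "sphere 0 1 \<subseteq> (\<Union>u\<in>sphere 0 1. ball u (e u))"
    using e(1) by force
  then obtain D where D: "D \<subseteq> sphere 0 1" "finite D" "sphere 0 1 \<subseteq> (\<Union>u\<in>D. ball u (e u))"
    by (rule compactE_image[OF compact_sphere, rotated]) auto
  \<comment> \<open>Inserting 1 keeps the minimum well-defined without arguing that \<open>D\<close> is nonempty.\<close>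
  define C where "C = Min (insert 1 (e ` D))"
  have "C > 0"
    unfolding C_def using D(1,2) e(1) by (subst Min_gr_iff) auto
  have C_le: "C \<le> e u" if "u \<in> D" for u
    unfolding C_def using D(2) that by (intro Min_le) auto
  have "f x + ereal (C * norm (y - x) ^ k) \<le> f y" if y: "dist y x < C" for y
  proof (cases "y = x")
    case True
    then show ?thesis using \<open>k > 0\<close> fx by (simp add: zero_power)
  next
    case False
    define t where "t = norm (y - x)"
    define v where "v = (y - x) /\<^sub>R t"
    have t: "0 < t" "t < C"
      using False y by (auto simp: t_def dist_norm)
    have "v \<in> sphere 0 1"
      using t(1) by (simp add: v_def t_def)
    then obtain u where u: "u \<in> D" "dist v u < e u"
      using D(3) by (auto simp: dist_commute)
    have "f x + ereal (e u * t ^ k) \<le> f (x + t *\<^sub>R v)"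
      using u D(1) t C_le[OF u(1)] by (intro e(2)) auto
    also have "x + t *\<^sub>R v = y"
      using t(1) by (simp add: v_def)
    finally have "f x + ereal (e u * t ^ k) \<le> f y" .
    moreover have "f x + ereal (C * t ^ k) \<le> f x + ereal (e u * t ^ k)"
      using C_le[OF u(1)] t(1) by (intro add_left_mono) (simp add: mult_right_mono)
    ultimately show ?thesis
      unfolding t_def by (rule order_trans[rotated])
  qed
  then have "grows_near f x C k"
    unfolding grows_near_def eventually_nhds_metric using \<open>C > 0\<close> by blast
  with \<open>C > 0\<close> show ?thesis by blast
qed

lemma isolated_local_minimizer_iff_hadamard:
  assumes fx: "f x = ereal a" and "k > 0"
  shows "isolated_local_minimizer f k x \<longleftrightarrow>
    (\<forall>u. u \<noteq> 0 \<longrightarrow> hadamard_deriv f x (replicate (k - 1) zero_form) u > 0)"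
proof
  assume "isolated_local_minimizer f k x"
  then obtain C where C: "C > 0" "grows_near f x C k"
    unfolding isolated_local_minimizer_iff_grows_near by blast
  show "\<forall>u. u \<noteq> 0 \<longrightarrow> hadamard_deriv f x (replicate (k - 1) zero_form) u > 0"
  proof (intro allI impI)
    fix u :: 'a assume "u \<noteq> 0"
    then have "0 < ereal (fact k * (C * (norm u / 2) ^ k))"
      using C(1) by simp
    also have "\<dots> \<le> hadamard_deriv f x (replicate (k - 1) zero_form) u"
      using C by (intro hadamard_deriv_ge[where f=f and x=x, OF fx \<open>k > 0\<close>]) auto
    finally show "hadamard_deriv f x (replicate (k - 1) zero_form) u > 0" .
  qed
next
  assume "\<forall>u. u \<noteq> 0 \<longrightarrow> hadamard_deriv f x (replicate (k - 1) zero_form) u > 0"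
  then show "isolated_local_minimizer f k x"
    using hadamard_deriv_pos_imp_grows_near[where f=f and x=x and k=k, OF fx \<open>k > 0\<close>] fx
    unfolding isolated_local_minimizer_iff_grows_near edom_def by auto
qed

section \<open>Nonnegativity at an isolated local minimizer\<close>

lemma isolated_local_minimizer_imp_nonneg:
  assumes fx: "f x = ereal a" and "isolated_local_minimizer f n x" and "k > 0"
  shows "0 \<le> demyanov_deriv f k x"
    and "0 \<le> hadamard_deriv f x (replicate (k - 1) zero_form) u"
proof -
  have "grows_near f x 0 k"
    using assms(2) grows_near_weaken unfolding isolated_local_minimizer_iff_grows_near
    by (meson less_imp_le)
  from demyanov_deriv_ge[where f=f and x=x, OF fx this]
    hadamard_deriv_ge[where f=f and x=x, OF fx \<open>k > 0\<close> _ this, of u]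
  show "0 \<le> demyanov_deriv f k x" "0 \<le> hadamard_deriv f x (replicate (k - 1) zero_form) u"
    by (simp_all add: zero_ereal_def)
qed

theorem theorem5p7:
  fixes f :: "'a::euclidean_space \<Rightarrow> ereal" and x :: 'a and n :: nat
  assumes "proper_fun f" and "x \<in> edom f" and "n > 0"
  shows
    "((isolated_local_minimizer f n x \<and>
         (\<forall>k. 0 < k \<and> k < n \<longrightarrow> \<not> isolated_local_minimizer f k x))
      \<longleftrightarrow>
      (zero_form \<in> hadamard_subdiff f x [] \<and>
         (\<forall>i\<in>{1..n-1}. zero_form \<in> hadamard_subdiff f x (replicate (i - 1) zero_form)) \<and>
         (\<forall>u. u \<noteq> 0 \<longrightarrow> hadamard_deriv f x (replicate (n - 1) zero_form) u > 0) \<and>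
         (\<forall>k. 0 < k \<and> k < n \<longrightarrow>
            (\<exists>d. d \<noteq> 0 \<and> hadamard_deriv f x (replicate (k - 1) zero_form) d = 0))))
     \<and>
     ((isolated_local_minimizer f n x \<and>
         (\<forall>k. 0 < k \<and> k < n \<longrightarrow> \<not> isolated_local_minimizer f k x))
      \<longleftrightarrow>
      ((\<forall>k. 0 < k \<and> k < n \<longrightarrow> demyanov_deriv f k x = 0) \<and> demyanov_deriv f n x > 0))"
    (is "(?A \<longleftrightarrow> ?B) \<and> (?A \<longleftrightarrow> ?C)")
proof -
  obtain a where fx: "f x = ereal a"
    using finite_at_edom[OF assms(1,2)] .
  note demy = isolated_local_minimizer_iff_demyanov[where f=f and x=x, OF fx]
  note hada = isolated_local_minimizer_iff_hadamard[where f=f and x=x, OF fx]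
  note nonneg = isolated_local_minimizer_imp_nonneg[where f=f and x=x, OF fx]
  have "?B" if A: ?A
  proof (intro conjI)
    from A have min: "isolated_local_minimizer f n x" by simp
    show "zero_form \<in> hadamard_subdiff f x []"
      unfolding zero_form_in_hadamard_subdiff_iff using nonneg(2)[OF min, of 1] by simp
    show "\<forall>i\<in>{1..n-1}. zero_form \<in> hadamard_subdiff f x (replicate (i - 1) zero_form)"
      unfolding zero_form_in_hadamard_subdiff_iff using nonneg(2)[OF min] by auto
    show "\<forall>u. u \<noteq> 0 \<longrightarrow> hadamard_deriv f x (replicate (n - 1) zero_form) u > 0"
      using hada[OF \<open>n > 0\<close>] min by simp
    show "\<forall>k. 0 < k \<and> k < n \<longrightarrow>
        (\<exists>d. d \<noteq> 0 \<and> hadamard_deriv f x (replicate (k - 1) zero_form) d = 0)"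
    proof (intro allI impI)
      fix k assume k: "0 < k \<and> k < n"
      then obtain d where "d \<noteq> 0" "\<not> 0 < hadamard_deriv f x (replicate (k - 1) zero_form) d"
        using A hada[of k] by blast
      moreover have "0 \<le> hadamard_deriv f x (replicate (k - 1) zero_form) d"
        using nonneg(2)[OF min] k by blast
      ultimately show "\<exists>d. d \<noteq> 0 \<and> hadamard_deriv f x (replicate (k - 1) zero_form) d = 0"
        by (metis order_less_le)
    qed
  qed
  moreover have ?A if ?B
    using that hada \<open>n > 0\<close> by (metis order_less_irrefl)
  moreover have ?C if ?A
    using that demy nonneg(1) \<open>n > 0\<close> by (metis order_less_le)
  moreover have ?A if ?C
    using that demy \<open>n > 0\<close> by (metis order_less_irrefl)
  ultimately show ?thesis by blast
qed

end
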